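(* Let $m,n\ge 1$, let $A_1,\dots,A_n$ be real $m\times m$ matrices, and let $\varphi:\mathbb{R}^{m}\to\mathbb{R}^{n}$ be the quadratic map $\varphi(X)=(X^{t}A_1X,\ldots,X^{t}A_nX)$, where $X^{t}=(x^1,\ldots,x^m)$, between Euclidean spaces with their standard metrics. Then $\varphi$ is an $\infty$-harmonic map if and only if $\varphi$ is a constant map.
   Context: A smooth map $\varphi:(M,g)\to(N,h)$ between Riemannian manifolds is called $\infty$-harmonic if $\tfrac12\,{\rm d}\varphi({\rm grad}\,|{\rm d}\varphi|^2)=0$ on $M$, where $|{\rm d}\varphi|^2={\rm Trace}_g\,\varphi^*h$ is the energy density of $\varphi$ and the gradient is taken with respect to $g$. *)

theory Defs
  imports "HOL-Analysis.Analysis"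
begin

text \<open>
  Everything is stated for maps between Euclidean spaces with their standard (flat) metrics,
  with the tangent space at each point identified with the space itself; the differential of
  \<open>f\<close> at \<open>x\<close> is then \<open>frechet_derivative f (at x)\<close>.
\<close>

text \<open>\<open>Ck k f\<close>: \<open>f\<close> is of class \<open>C\<^sup>k\<close> on the whole space.\<close>

primrec Ck :: "nat \<Rightarrow> ('a::euclidean_space \<Rightarrow> 'b::euclidean_space) \<Rightarrow> bool" where
  "Ck 0 f \<longleftrightarrow> continuous_on UNIV f"
| "Ck (Suc k) f \<longleftrightarrow>
     (\<forall>x. f differentiable (at x)) \<and> (\<forall>v. Ck k (\<lambda>x. frechet_derivative f (at x) v))"

definition smooth_map :: "('a::euclidean_space \<Rightarrow> 'b::euclidean_space) \<Rightarrow> bool" where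
  "smooth_map f \<longleftrightarrow> (\<forall>k. Ck k f)"

definition pullback_metric ::
    "('a::euclidean_space \<Rightarrow> 'b::euclidean_space) \<Rightarrow> 'a \<Rightarrow> 'a \<Rightarrow> 'a \<Rightarrow> real" where
  "pullback_metric f x u v =
     frechet_derivative f (at x) u \<bullet> frechet_derivative f (at x) v"

text \<open>\<open>Basis\<close> is orthonormal, so the metric trace is the sum of the diagonal entries.\<close>

definition metric_trace :: "('a::euclidean_space \<Rightarrow> 'a \<Rightarrow> real) \<Rightarrow> real" where
  "metric_trace b = (\<Sum>e\<in>Basis. b e e)"

definition energy_density :: "('a::euclidean_space \<Rightarrow> 'b::euclidean_space) \<Rightarrow> 'a \<Rightarrow> real" where
  "energy_density f x = metric_trace (pullback_metric f x)"

definition grad :: "('a::euclidean_space \<Rightarrow> real) \<Rightarrow> 'a \<Rightarrow> 'a" where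
  "grad u x = (THE D. GDERIV u x :> D)"

definition infinity_harmonic :: "('a::euclidean_space \<Rightarrow> 'b::euclidean_space) \<Rightarrow> bool" where
  "infinity_harmonic f \<longleftrightarrow> smooth_map f \<and>
     (\<forall>x. (1/2) *\<^sub>R frechet_derivative f (at x) (grad (energy_density f) x) = 0)"

definition quadratic_map :: "('n::finite \<Rightarrow> real^'m^'m) \<Rightarrow> real^'m \<Rightarrow> real^'n" where
  "quadratic_map A X = (\<chi> i. X \<bullet> (A i *v X))"

end

theory Submission
  imports Defs
begin

text \<open>
  Put \<open>S\<^sub>i = A\<^sub>i + A\<^sub>i\<^sup>t\<close> and \<open>Q = \<Sum>\<^sub>i S\<^sub>i\<^sup>2\<close>. The energy density is \<open>\<Sum>\<^sub>i \<bar>S\<^sub>i X\<bar>\<^sup>2\<close>, with gradient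
  \<open>2 Q X\<close>, so infinity-harmonicity says that \<open>S\<^sub>i X \<bullet> Q X = 0\<close> for all \<open>i\<close> and \<open>X\<close>. Polarise this
  identity, evaluate it at the pair \<open>X, S\<^sub>i X\<close> and sum over \<open>i\<close>: the result is
  \<open>\<Sum>\<^sub>i S\<^sub>i X \<bullet> Q (S\<^sub>i X) + \<bar>Q X\<bar>\<^sup>2 = 0\<close>. As \<open>Q\<close> is positive semidefinite, \<open>Q = 0\<close>, hence all \<open>S\<^sub>i\<close> vanish.
\<close>

lemma self_adjoint_family_eq_0:
  fixes S :: "'i \<Rightarrow> 'a::real_inner \<Rightarrow> 'a"
  assumes "finite I"
    and lin: "\<And>i. i \<in> I \<Longrightarrow> linear (S i)"
    and sa: "\<And>i x y. i \<in> I \<Longrightarrow> S i x \<bullet> y = x \<bullet> S i y"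
    and orth: "\<And>i x. i \<in> I \<Longrightarrow> S i x \<bullet> (\<Sum>j\<in>I. S j (S j x)) = 0"
    and "i \<in> I"
  shows "S i x = 0"
proof -
  define Q where "Q x = (\<Sum>j\<in>I. S j (S j x))" for x
  have Q_add: "Q (x + y) = Q x + Q y" for x y
    unfolding Q_def sum.distrib[symmetric]
    by (intro sum.cong refl) (simp add: lin linear_add)
  have Q_form: "x \<bullet> Q x = (\<Sum>j\<in>I. (norm (S j x))\<^sup>2)" for x
    unfolding Q_def inner_sum_right power2_norm_eq_inner
    by (intro sum.cong refl) (simp add: sa)
  have polar: "S j x \<bullet> Q y + S j y \<bullet> Q x = 0" if "j \<in> I" for j x y
    using orth[OF that, of "x + y"] orth[OF that, of x] orth[OF that, of y]
    by (simp add: Q_def[symmetric] Q_add linear_add[OF lin[OF that]] inner_add)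
  have "0 = (\<Sum>j\<in>I. S j x \<bullet> Q (S j x) + S j (S j x) \<bullet> Q x)"
    by (simp add: polar)
  also have "\<dots> = (\<Sum>j\<in>I. S j x \<bullet> Q (S j x)) + Q x \<bullet> Q x"
    by (simp add: sum.distrib inner_sum_left Q_def)
  finally have "(\<Sum>j\<in>I. S j x \<bullet> Q (S j x)) + Q x \<bullet> Q x = 0"
    by simp
  moreover have "0 \<le> (\<Sum>j\<in>I. S j x \<bullet> Q (S j x))"
    by (simp add: Q_form sum_nonneg)
  ultimately have "Q x \<bullet> Q x = 0"
    using inner_ge_zero[of "Q x"] by linarith
  \<comment> \<open>Since \<open>Q x\<close> vanishes, so does \<open>x \<bullet> Q x\<close>, which
    by \<open>Q_form\<close> is a sum of squares.\<close>
  then have "(\<Sum>j\<in>I. (norm (S j x))\<^sup>2) = 0"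
    by (simp flip: Q_form)
  then show ?thesis
    using \<open>finite I\<close> \<open>i \<in> I\<close> by (simp add: sum_nonneg_eq_0_iff)
qed

lemma Ck_const: "Ck k (\<lambda>x. c)"
  by (induction k arbitrary: c) (simp_all add: frechet_derivative_const)

text \<open>The differential is zero, so it kills the gradient whatever its value.\<close>

lemma infinity_harmonic_const: "infinity_harmonic (\<lambda>x. c)"
  by (simp add: infinity_harmonic_def smooth_map_def Ck_const frechet_derivative_const)

text \<open>The derivative is unique and the inner product is nondegenerate, so at most one vector
  represents it.\<close>

lemma grad_eq:
  assumes "GDERIV u x :> D"
  shows "grad u x = D"
  unfolding grad_def
proof (rule the_equality[where P = "\<lambda>D. GDERIV u x :> D", OF assms])
  fix D' assume "GDERIV u x :> D'"
  then have "(\<lambda>h. h \<bullet> D') = (\<lambda>h. h \<bullet> D)"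
    using assms unfolding gderiv_def by (rule has_derivative_unique)
  then show "D' = D"
    by (metis vector_eq_ldot)
qed

text \<open>The right-hand side is the derivative of the form \<open>x \<bullet> (A *v x)\<close> at
  \<open>x\<close> in direction \<open>y\<close>. It is symmetric in \<open>x\<close> and
  \<open>y\<close>, which later gives self-adjointness.\<close>

lemma inner_symmetric_part:
  fixes A :: "real^'m^'m"
  shows "((A + transpose A) *v x) \<bullet> y = (A *v x) \<bullet> y + x \<bullet> (A *v y)"
  by (simp add: matrix_vector_mult_add_rdistrib inner_add_left dot_lmul_matrix
      transpose_matrix_vector)

lemma has_derivative_quadratic_map:
  fixes A :: "'n::finite \<Rightarrow> real^'m^'m"
  shows "(quadratic_map A has_derivative
    (\<lambda>v. \<chi> i. ((A i + transpose (A i)) *v x) \<bullet> v)) (at x)"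
proof -
  have "((\<lambda>X. X \<bullet> (A i *v X)) has_derivative
      (\<lambda>v. ((A i + transpose (A i)) *v x) \<bullet> v)) (at x)" for i
    by (rule derivative_eq_intros bounded_linear.has_derivative[OF matrix_vector_mul_bounded_linear] refl)+
      (simp add: fun_eq_iff inner_symmetric_part inner_commute[of _ "A i *v x"])
  then show ?thesis
    unfolding has_derivative_componentwise_within[of "quadratic_map A"]
    by (auto simp: Basis_vec_def inner_axis quadratic_map_def)
qed

lemma energy_density_quadratic_map:
  fixes A :: "'n::finite \<Rightarrow> real^'m^'m"
  shows "energy_density (quadratic_map A) =
    (\<lambda>x. \<Sum>i\<in>UNIV. ((A i + transpose (A i)) *v x) \<bullet> ((A i + transpose (A i)) *v x))"
proof
  fix x
  define S where "S i = (A i + transpose (A i)) *v x" for i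
  have "energy_density (quadratic_map A) x = (\<Sum>e\<in>Basis. \<Sum>i\<in>UNIV. (S i \<bullet> e) * (S i \<bullet> e))"
    by (simp add: energy_density_def metric_trace_def pullback_metric_def inner_vec_def S_def
        flip: frechet_derivative_at[OF has_derivative_quadratic_map])
  \<comment> \<open>The trace is the squared Frobenius norm of the differential, collected by
    columns. Collected by rows instead, it is the sum of the squared norms of the row vectors
    \<open>S i\<close>.\<close>
  also have "\<dots> = (\<Sum>i\<in>UNIV. \<Sum>e\<in>Basis. (S i \<bullet> e) * (S i \<bullet> e))"
    by (rule sum.swap)
  also have "\<dots> = (\<Sum>i\<in>UNIV. S i \<bullet> S i)"
    by (intro sum.cong refl euclidean_inner[symmetric])
  finally show "energy_density (quadratic_map A) x =
      (\<Sum>i\<in>UNIV. ((A i + transpose (A i)) *v x) \<bullet> ((A i + transpose (A i)) *v x))"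
    by (simp add: S_def)
qed

lemma symmetric_part_self_adjoint:
  fixes A :: "real^'m^'m"
  shows "((A + transpose A) *v x) \<bullet> y = x \<bullet> ((A + transpose A) *v y)"
  using inner_symmetric_part[of A x y] inner_symmetric_part[of A y x]
  by (simp add: inner_commute)

lemma grad_energy_density_quadratic_map:
  fixes A :: "'n::finite \<Rightarrow> real^'m^'m"
  shows "grad (energy_density (quadratic_map A)) x =
    2 *\<^sub>R (\<Sum>i\<in>UNIV. (A i + transpose (A i)) *v ((A i + transpose (A i)) *v x))"
proof (rule grad_eq)
  define S where "S i = A i + transpose (A i)" for i
  have sa: "(S i *v x) \<bullet> y = x \<bullet> (S i *v y)" for i x y
    unfolding S_def by (rule symmetric_part_self_adjoint)
  have "((\<lambda>x. \<Sum>i\<in>UNIV. (S i *v x) \<bullet> (S i *v x)) has_derivative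
      (\<lambda>h. \<Sum>i\<in>UNIV. (S i *v x) \<bullet> (S i *v h) + (S i *v h) \<bullet> (S i *v x))) (at x)"
    by (intro has_derivative_sum has_derivative_inner
        bounded_linear_imp_has_derivative matrix_vector_mul_bounded_linear)
  \<comment> \<open>Both summands agree, and self-adjointness frees \<open>h\<close> from
    \<open>S i\<close>, so that the gradient can be read off.\<close>
  moreover have "(\<lambda>h. \<Sum>i\<in>UNIV. (S i *v x) \<bullet> (S i *v h) + (S i *v h) \<bullet> (S i *v x)) =
      (\<lambda>h. h \<bullet> (2 *\<^sub>R (\<Sum>i\<in>UNIV. S i *v (S i *v x))))"
    unfolding inner_commute[of "S _ *v x"]
    by (simp add: fun_eq_iff inner_sum_right sum_distrib_left sa)
  ultimately show "GDERIV (energy_density (quadratic_map A)) x :>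
      2 *\<^sub>R (\<Sum>i\<in>UNIV. (A i + transpose (A i)) *v ((A i + transpose (A i)) *v x))"
    by (simp add: gderiv_def energy_density_quadratic_map S_def)
qed

theorem theorem2p2:
  fixes A :: "'n::finite \<Rightarrow> real^'m^'m"
  shows "infinity_harmonic (quadratic_map A) \<longleftrightarrow> quadratic_map A constant_on UNIV"
proof
  assume harm: "infinity_harmonic (quadratic_map A)"
  define S where "S i = (*v) (A i + transpose (A i))" for i
  \<comment> \<open>This is the \<open>i\<close>-th component of the infinity-harmonic equation, up
    to the factor 2 of the gradient.\<close>
  have orth: "S i x \<bullet> (\<Sum>j\<in>UNIV. S j (S j x)) = 0" for i x
  proof -
    have "frechet_derivative (quadratic_map A) (at x) (grad (energy_density (quadratic_map A)) x) = 0"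
      using harm by (simp add: infinity_harmonic_def)
    then show ?thesis
      by (simp add: vec_eq_iff grad_energy_density_quadratic_map S_def
          flip: frechet_derivative_at[OF has_derivative_quadratic_map])
  qed
  have "S i x = 0" for i x
    by (rule self_adjoint_family_eq_0[of UNIV S])
      (use orth in \<open>auto simp: S_def symmetric_part_self_adjoint\<close>)
  \<comment> \<open>The matrices \<open>A i\<close> are now skew-symmetric. They may be nonzero, but
    their quadratic forms vanish.\<close>
  then have "x \<bullet> (A i *v x) = 0" for i x
    using inner_symmetric_part[of "A i" x x] by (simp add: S_def inner_commute)
  then have "quadratic_map A = (\<lambda>x. 0)"
    by (simp add: quadratic_map_def fun_eq_iff vec_eq_iff)
  then show "quadratic_map A constant_on UNIV"
    by (auto simp: constant_on_def)
next
  assume "quadratic_map A constant_on UNIV"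
  then obtain c where "quadratic_map A = (\<lambda>x. c)"
    by (auto simp: constant_on_def)
  then show "infinity_harmonic (quadratic_map A)"
    by (simp add: infinity_harmonic_const)
qed

end
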